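(* Let $\mathcal{P}$ be a finite-dimensional Poisson algebra over a field $\mathbb{F}$ of characteristic zero, and let $R$ be its solvable radical. Then $R^2=R\cdot R+[R,R]$ is nilpotent.
   Context: A Poisson algebra $(\mathcal{P},\cdot,[\cdot,\cdot])$ over $\mathbb{F}$ is a vector space with two bilinear products such that $(\mathcal{P},\cdot)$ is a commutative associative algebra (not necessarily unital), $(\mathcal{P},[\cdot,\cdot])$ is a Lie algebra, and $[x\cdot y,z]=[x,z]\cdot y+x\cdot[y,z]$ for all $x,y,z$. For subspaces $X,Y$, $X\cdot Y$ and $[X,Y]$ denote the linear spans of all products. An ideal is a subspace $I$ with $I\cdot\mathcal{P}+[I,\mathcal{P}]\subseteq I$. A Poisson algebra $A$ is solvable if $A^{(m)}=0$ for some $m$, where $A^{(0)}=A$ and $A^{(n+1)}=A^{(n)}\cdot A^{(n)}+[A^{(n)},A^{(n)}]$; it is nilpotent if $A^m=0$ for some $m$, where $A^1=A$ and $A^{n+1}=\sum_{i=1}^{n}(A^i\cdot A^{n+1-i}+[A^i,A^{n+1-i}])$. The (solvable) radical $R=R(\mathcal{P})$ is the largest solvable ideal of $\mathcal{P}$. *)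

theory Defs
  imports Complex_Main "HOL-Library.Set_Algebras"
begin

text \<open>
  Subspaces are sets of vectors; \<open>+\<close> and \<open>\<Sum>\<close> on sets are the elementwise (Minkowski)
  operations of \<^theory>\<open>HOL-Library.Set_Algebras\<close>, hence sums of subspaces.
\<close>

locale poisson_algebra = vector_space scale
  for scale :: "'f::field \<Rightarrow> 'p::ab_group_add \<Rightarrow> 'p" +
  fixes mult :: "'p \<Rightarrow> 'p \<Rightarrow> 'p"  (infixl \<open>\<cdot>\<close> 70)
    and bracket :: "'p \<Rightarrow> 'p \<Rightarrow> 'p"
  assumes mult_linear_left: "Vector_Spaces.linear scale scale (\<lambda>x. x \<cdot> y)"
    and mult_linear_right: "Vector_Spaces.linear scale scale (\<lambda>y. x \<cdot> y)"
    and mult_commute: "x \<cdot> y = y \<cdot> x"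
    and mult_assoc: "(x \<cdot> y) \<cdot> z = x \<cdot> (y \<cdot> z)"
    and bracket_linear_left: "Vector_Spaces.linear scale scale (\<lambda>x. bracket x y)"
    and bracket_linear_right: "Vector_Spaces.linear scale scale (\<lambda>y. bracket x y)"
    and bracket_self: "bracket x x = 0"
    and jacobi: "bracket x (bracket y z) + bracket y (bracket z x) + bracket z (bracket x y) = 0"
    and leibniz: "bracket (x \<cdot> y) z = bracket x z \<cdot> y + x \<cdot> bracket y z"
begin

definition mult_span :: "'p set \<Rightarrow> 'p set \<Rightarrow> 'p set" where
  "mult_span X Y = span {x \<cdot> y | x y. x \<in> X \<and> y \<in> Y}"

definition bracket_span :: "'p set \<Rightarrow> 'p set \<Rightarrow> 'p set" where
  "bracket_span X Y = span {bracket x y | x y. x \<in> X \<and> y \<in> Y}"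

definition ideal :: "'p set \<Rightarrow> bool" where
  "ideal I \<longleftrightarrow> subspace I \<and> mult_span I UNIV + bracket_span I UNIV \<subseteq> I"

definition square :: "'p set \<Rightarrow> 'p set" where
  "square A = mult_span A A + bracket_span A A"

primrec derived :: "'p set \<Rightarrow> nat \<Rightarrow> 'p set" where
  "derived A 0 = A"
| "derived A (Suc n) = square (derived A n)"

definition solvable :: "'p set \<Rightarrow> bool" where
  "solvable A \<longleftrightarrow> (\<exists>m. derived A m = {0})"

text \<open>The powers \<open>A\<^sup>n\<close> start at \<open>n = 1\<close>; the value at \<open>0\<close> is a dummy, excluded in
  \<open>nilpotent\<close>.\<close>

fun pow :: "'p set \<Rightarrow> nat \<Rightarrow> 'p set" where
  "pow A 0 = A"
| "pow A (Suc 0) = A"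
| "pow A (Suc (Suc n)) =
     (\<Sum>i = 1..Suc n. mult_span (pow A i) (pow A (Suc (Suc n) - i))
                    + bracket_span (pow A i) (pow A (Suc (Suc n) - i)))"

definition nilpotent :: "'p set \<Rightarrow> bool" where
  "nilpotent A \<longleftrightarrow> (\<exists>m\<ge>1. pow A m = {0})"

text \<open>The largest solvable ideal exists in finite dimension, as a sum of two solvable ideals is
  solvable; without such an existence argument \<^const>\<open>Greatest\<close> is unspecified.\<close>

definition radical :: "'p set" where
  "radical = (GREATEST I. ideal I \<and> solvable I)"

end

end

theory Submission
  imports Defs "HOL-Computational_Algebra.Polynomial"
begin

text \<open>
  The statement combines two facts: a solvable ideal is nilpotent for the commutative product, and,
  by Lie's theorem in characteristic zero, the commutators of a solvable Lie algebra act nilpotently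
  on a finite-dimensional module. Both become visible on a chief factor \<open>W / W'\<close>, a pair of ideals
  of the Poisson algebra with no ideal strictly between them. Every solvable ideal \<open>I\<close> satisfies
  \<open>I \<cdot> W \<subseteq> W'\<close> (\<open>solvable_ideal_mult_trivial\<close>), and \<open>square I\<close> acts as zero on \<open>W / W'\<close> through
  both products (\<open>solvable_ideal_square_acts_trivially\<close>). Along a chief series of the whole algebra,
  each application of \<open>square I\<close> therefore descends by one step, so long right-normed products
  of elements of \<open>square I\<close> vanish. The Leibniz and Jacobi identities rewrite arbitrarily
  parenthesised products into right-normed ones (\<open>product_span_lower_central\<close>), which gives
  nilpotency.

  The Lie-theoretic part works over any field of characteristic zero, with neither eigenvectors nor
  traces. If \<open>b = bracket x a\<close> commutes with \<open>a\<close> as an operator on \<open>W / W'\<close>, then commuting with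
  \<open>x\<close> turns \<open>q(a)\<close> into \<open>q'(a) b\<close> for every polynomial \<open>q\<close>. Applied to the minimal polynomial of
  \<open>a\<close>, this excludes that \<open>b\<close> is injective (\<open>commutator_not_injective\<close>). On a chief factor the
  generalised kernel of \<open>b\<close> is everything or zero, under suitable commutation hypotheses, so \<open>b\<close> is
  locally nilpotent. A commuting family of such \<open>b\<close> has a non-zero common kernel, and if the
  family spans a space closed under brackets with all elements, this kernel is an ideal, hence
  everything (\<open>commutators_act_trivially\<close>). Descending the derived series of \<open>I\<close>, this is applied
  twice at each term: to make the term act by central operators, and then to make it act
  trivially.
\<close>

section \<open>Polynomials in an endomorphism\<close>

text \<open>The vector \<open>q(f) v\<close>, by Horner's scheme, so that induction over \<open>pCons\<close> applies.\<close>

definition poly_action ::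
    "('a::zero \<Rightarrow> 'b::ab_group_add \<Rightarrow> 'b) \<Rightarrow> ('b \<Rightarrow> 'b) \<Rightarrow> 'a poly \<Rightarrow> 'b \<Rightarrow> 'b" where
  "poly_action scale f q = fold_coeffs (\<lambda>c g v. scale c v + f (g v)) q (\<lambda>v. 0)"

locale vector_space_endomorphism = vector_space scale
  for scale :: "'a::field \<Rightarrow> 'b::ab_group_add \<Rightarrow> 'b" +
  fixes f :: "'b \<Rightarrow> 'b"
  assumes endo_add: "f (u + v) = f u + f v" and endo_scale: "f (scale c v) = scale c (f v)"
begin

lemma endo_0: "f 0 = 0"
  using endo_scale[of 0 0] by simp

lemma poly_action_0: "poly_action scale f 0 v = 0"
  by (simp add: poly_action_def)

lemma poly_action_pCons: "poly_action scale f (pCons c q) v = scale c v + f (poly_action scale f q v)"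
  by (cases "c = 0 \<and> q = 0") (auto simp: poly_action_def endo_0)

lemma poly_action_add: "poly_action scale f (p + q) v = poly_action scale f p v + poly_action scale f q v"
  by (induction p q rule: poly_induct2)
    (simp_all add: poly_action_0 poly_action_pCons endo_add scale_left_distrib)

lemma poly_action_smult: "poly_action scale f (smult c q) v = scale c (poly_action scale f q v)"
  by (induction q) (simp_all add: poly_action_0 poly_action_pCons endo_scale scale_right_distrib)

lemma poly_action_diff: "poly_action scale f (p - q) v = poly_action scale f p v - poly_action scale f q v"
proof -
  have "poly_action scale f (p - q) v + poly_action scale f q v = poly_action scale f p v"
    by (simp flip: poly_action_add)
  then show ?thesis by (simp add: algebra_simps)
qed

lemma poly_action_vec_0: "poly_action scale f q 0 = 0"
  by (induction q) (simp_all add: poly_action_0 poly_action_pCons endo_0)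

lemma poly_action_vec_add: "poly_action scale f q (u + v) = poly_action scale f q u + poly_action scale f q v"
  by (induction q) (simp_all add: poly_action_0 poly_action_pCons endo_add scale_right_distrib)

lemma poly_action_vec_scale: "poly_action scale f q (scale c v) = scale c (poly_action scale f q v)"
  by (induction q)
    (simp_all add: poly_action_0 poly_action_pCons endo_scale scale_right_distrib mult.commute)

lemma poly_action_mult: "poly_action scale f (p * q) v = poly_action scale f p (poly_action scale f q v)"
  by (induction p)
    (simp_all add: poly_action_0 poly_action_pCons poly_action_add poly_action_smult)

end

context finite_dimensional_vector_space
begin

lemma subspace_of_maximal_dim:
  assumes "Q U" and sub: "\<And>U. Q U \<Longrightarrow> subspace U"
  shows "\<exists>U. Q U \<and> (\<forall>T. Q T \<longrightarrow> U \<subseteq> T \<longrightarrow> T = U)"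
proof -
  obtain U where U: "Q U" and max: "\<And>T. Q T \<Longrightarrow> dim T \<le> dim U"
    using ex_has_greatest_nat[of Q U dim "Suc dimension"] assms(1) dim_subset_UNIV
    by (auto simp: less_Suc_eq_le)
  have "T = U" if T: "Q T" "U \<subseteq> T" for T
    using subspace_dim_equal[OF sub[OF U] sub[OF T(1)] T(2) max[OF T(1)]] by simp
  then show ?thesis using U by blast
qed

text \<open>The spaces \<open>{q(f) v | deg q < n}\<close> would grow strictly with \<open>n\<close> if no non-zero
  polynomial annihilated \<open>v\<close>.\<close>

lemma poly_annihilating_vector:
  assumes "vector_space_endomorphism scale f"
  shows "\<exists>q. q \<noteq> 0 \<and> poly_action scale f q v = 0"
proof (rule ccontr)
  interpret vector_space_endomorphism scale f by fact
  assume "\<not> ?thesis"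
  then have free: "q = 0" if "poly_action scale f q v = 0" for q
    using that by blast
  define V where "V n = {poly_action scale f q v | q. \<forall>i\<ge>n. coeff q i = 0}" for n
  have sub: "subspace (V n)" for n
  proof (rule subspaceI)
    show "0 \<in> V n"
      unfolding V_def using poly_action_0[of v] by (intro CollectI exI[of _ 0]) simp
  next
    fix x y assume "x \<in> V n" "y \<in> V n"
    then obtain p q where "x = poly_action scale f p v" "y = poly_action scale f q v"
      "\<forall>i\<ge>n. coeff p i = 0" "\<forall>i\<ge>n. coeff q i = 0" unfolding V_def by blast
    then show "x + y \<in> V n"
      unfolding V_def by (intro CollectI exI[of _ "p + q"]) (simp add: poly_action_add)
  next
    fix c x assume "x \<in> V n"
    then obtain q where "x = poly_action scale f q v" "\<forall>i\<ge>n. coeff q i = 0" unfolding V_def by blast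
    then show "scale c x \<in> V n"
      unfolding V_def by (intro CollectI exI[of _ "smult c q"]) (simp add: poly_action_smult)
  qed
  have "n \<le> dim (V n)" for n
  proof (induction n)
    case (Suc n)
    have le: "V n \<subseteq> V (Suc n)" unfolding V_def by auto
    have "poly_action scale f (monom 1 n) v \<in> V (Suc n)"
      unfolding V_def by (intro CollectI exI[of _ "monom 1 n"]) simp
    moreover have "poly_action scale f (monom 1 n) v \<notin> V n"
    proof
      assume "poly_action scale f (monom 1 n) v \<in> V n"
      then obtain q where q: "poly_action scale f (monom 1 n) v = poly_action scale f q v"
        "\<forall>i\<ge>n. coeff q i = 0" unfolding V_def by blast
      then have "monom 1 n - q = 0"
        by (intro free) (simp add: poly_action_diff)
      then have "coeff (monom 1 n :: 'a poly) n = coeff q n" by simp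
      with q(2) show False by simp
    qed
    ultimately have "V n \<noteq> V (Suc n)" by blast
    then have "\<not> dim (V (Suc n)) \<le> dim (V n)"
      using subspace_dim_equal[OF sub sub le] by blast
    with Suc show ?case by simp
  qed simp
  from this[of "Suc dimension"] dim_subset_UNIV[of "V (Suc dimension)"] show False by simp
qed

text \<open>The product of polynomials annihilating the basis vectors annihilates the whole space.\<close>

lemma poly_annihilating_endomorphism:
  assumes "vector_space_endomorphism scale f"
  shows "\<exists>q. q \<noteq> 0 \<and> (\<forall>v. poly_action scale f q v = 0)"
proof -
  interpret vector_space_endomorphism scale f by fact
  have "\<exists>q. q \<noteq> 0 \<and> (\<forall>v\<in>B. poly_action scale f q v = 0)" if "finite B" for B
    using that
  proof (induction B)
    case empty
    show ?case by (intro exI[of _ 1]) simp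
  next
    case (insert b B)
    then obtain p where p: "p \<noteq> 0" "\<forall>v\<in>B. poly_action scale f p v = 0" by blast
    obtain q where q: "q \<noteq> 0" "poly_action scale f q b = 0"
      using poly_annihilating_vector[OF assms] by blast
    have "poly_action scale f (q * p) v = 0" if "v \<in> B" for v
      using p(2) that by (simp add: poly_action_mult poly_action_vec_0)
    moreover have "poly_action scale f (q * p) b = 0"
      using q(2) by (subst mult.commute) (simp add: poly_action_mult poly_action_vec_0)
    ultimately show ?case using p(1) q(1) by (intro exI[of _ "q * p"]) auto
  qed
  then obtain q where q: "q \<noteq> 0" "\<forall>v\<in>Basis. poly_action scale f q v = 0"
    using finite_Basis by blast
  have "subspace {v. poly_action scale f q v = 0}"
    by (rule subspaceI) (simp_all add: poly_action_vec_0 poly_action_vec_add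
        poly_action_vec_scale)
  then have "span Basis \<subseteq> {v. poly_action scale f q v = 0}"
    using q(2) by (intro span_minimal) auto
  then show ?thesis using q(1) span_Basis by blast
qed

end

section \<open>Ideals and the solvable radical\<close>

context poisson_algebra
begin

lemma mult_add_left: "(x + y) \<cdot> z = x \<cdot> z + y \<cdot> z"
  and mult_scale_left: "scale c x \<cdot> z = scale c (x \<cdot> z)"
  and mult_add_right: "z \<cdot> (x + y) = z \<cdot> x + z \<cdot> y"
  and mult_scale_right: "z \<cdot> scale c x = scale c (z \<cdot> x)"
  and bracket_add_left: "bracket (x + y) z = bracket x z + bracket y z"
  and bracket_scale_left: "bracket (scale c x) z = scale c (bracket x z)"
  and bracket_add_right: "bracket z (x + y) = bracket z x + bracket z y"
  and bracket_scale_right: "bracket z (scale c x) = scale c (bracket z x)"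
  using mult_linear_left[of z] mult_linear_right[of z]
    bracket_linear_left[of z] bracket_linear_right[of z]
  unfolding Vector_Spaces.linear_iff by auto

lemma mult_0_left: "0 \<cdot> x = 0" and mult_0_right: "x \<cdot> 0 = 0"
  and bracket_0_left: "bracket 0 x = 0" and bracket_0_right: "bracket x 0 = 0"
  using mult_add_left[of 0 0 x] mult_add_right[of x 0 0]
    bracket_add_left[of 0 0 x] bracket_add_right[of x 0 0] by auto

sublocale ad: vector_space_endomorphism scale "bracket a" for a
  by unfold_locales (simp_all add: bracket_add_right bracket_scale_right)

lemma bracket_minus_right: "bracket z (- x) = - bracket z x"
  using bracket_scale_right[of z "-1" x] by simp

lemma bracket_diff_right: "bracket z (x - y) = bracket z x - bracket z y"
  using bracket_add_right[of z x "- y"] by (simp add: bracket_minus_right)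

lemmas bilinear = mult_add_left mult_scale_left mult_add_right mult_scale_right
  bracket_add_left bracket_scale_left bracket_add_right bracket_scale_right
  mult_0_left mult_0_right bracket_0_left bracket_0_right

lemma bracket_skew: "bracket x y = - bracket y x"
proof -
  have "bracket x y + bracket y x = 0"
    using bracket_self[of "x + y"] unfolding bracket_add_left bracket_add_right
    by (simp add: bracket_self add.commute)
  then show ?thesis by (rule eq_neg_iff_add_eq_0[THEN iffD2])
qed

text \<open>The Jacobi identity as the statement that \<open>bracket x\<close> is a derivation of the bracket.\<close>

lemma jacobi_derivation: "bracket x (bracket y z) = bracket (bracket x y) z + bracket y (bracket x z)"
proof -
  have "bracket y (bracket z x) = - bracket y (bracket x z)"
    by (subst bracket_skew[of z x]) (rule bracket_minus_right)
  moreover have "bracket z (bracket x y) = - bracket (bracket x y) z"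
    by (rule bracket_skew)
  ultimately show ?thesis using jacobi[of x y z] by (simp add: algebra_simps)
qed

lemma leibniz_right: "bracket z (x \<cdot> y) = bracket z x \<cdot> y + x \<cdot> bracket z y"
proof -
  have "bracket z (x \<cdot> y) = - (bracket x z \<cdot> y + x \<cdot> bracket y z)"
    by (subst bracket_skew) (simp add: leibniz)
  also have "\<dots> = bracket z x \<cdot> y + x \<cdot> bracket z y"
    using bracket_skew[of z x] bracket_skew[of z y] mult_scale_left[of "-1" "bracket x z" y]
      mult_scale_right[of x "-1" "bracket y z"] by simp
  finally show ?thesis .
qed

definition product_span :: "'p set \<Rightarrow> 'p set \<Rightarrow> 'p set" where
  "product_span X Y = mult_span X Y + bracket_span X Y"

lemma square_eq_product_span: "square A = product_span A A"
  by (simp add: square_def product_span_def)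

lemma subspace_plus: "subspace X \<Longrightarrow> subspace Y \<Longrightarrow> subspace (X + Y)"
  using subspace_sums[of X Y] by (simp add: set_plus_def Bex_def conj_ac)

lemma plus_subset_subspace_iff:
  assumes "subspace Z" "subspace X" "subspace Y"
  shows "X + Y \<subseteq> Z \<longleftrightarrow> X \<subseteq> Z \<and> Y \<subseteq> Z"
proof
  assume "X + Y \<subseteq> Z"
  moreover have "X \<subseteq> X + Y" "Y \<subseteq> X + Y"
    using set_zero_plus2[OF subspace_0[OF assms(3)], of X]
      set_zero_plus2[OF subspace_0[OF assms(2)], of Y] by (simp_all add: add.commute)
  ultimately show "X \<subseteq> Z \<and> Y \<subseteq> Z" by blast
next
  assume "X \<subseteq> Z \<and> Y \<subseteq> Z"
  then show "X + Y \<subseteq> Z" using assms(1) by (auto simp: set_plus_def intro!: subspace_add)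
qed

lemma subspace_product_spans:
  "subspace (mult_span X Y)" "subspace (bracket_span X Y)" "subspace (product_span X Y)"
  by (simp_all add: mult_span_def bracket_span_def product_span_def subspace_plus)

lemma mult_span_subset_iff:
  assumes "subspace Z"
  shows "mult_span X Y \<subseteq> Z \<longleftrightarrow> (\<forall>x\<in>X. \<forall>y\<in>Y. x \<cdot> y \<in> Z)"
proof
  assume "mult_span X Y \<subseteq> Z"
  then show "\<forall>x\<in>X. \<forall>y\<in>Y. x \<cdot> y \<in> Z"
    unfolding mult_span_def by (blast intro: span_base)
next
  assume "\<forall>x\<in>X. \<forall>y\<in>Y. x \<cdot> y \<in> Z"
  then show "mult_span X Y \<subseteq> Z" unfolding mult_span_def by (intro span_minimal assms) blast
qed

lemma bracket_span_subset_iff: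
  assumes "subspace Z"
  shows "bracket_span X Y \<subseteq> Z \<longleftrightarrow> (\<forall>x\<in>X. \<forall>y\<in>Y. bracket x y \<in> Z)"
proof
  assume "bracket_span X Y \<subseteq> Z"
  then show "\<forall>x\<in>X. \<forall>y\<in>Y. bracket x y \<in> Z"
    unfolding bracket_span_def by (blast intro: span_base)
next
  assume "\<forall>x\<in>X. \<forall>y\<in>Y. bracket x y \<in> Z"
  then show "bracket_span X Y \<subseteq> Z" unfolding bracket_span_def by (intro span_minimal assms) blast
qed

lemma product_span_subset_iff:
  assumes "subspace Z"
  shows "product_span X Y \<subseteq> Z \<longleftrightarrow> (\<forall>x\<in>X. \<forall>y\<in>Y. x \<cdot> y \<in> Z \<and> bracket x y \<in> Z)"
  unfolding product_span_def plus_subset_subspace_iff[OF assms subspace_product_spans(1,2)]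
    mult_span_subset_iff[OF assms] bracket_span_subset_iff[OF assms] by blast

lemma product_spanI:
  assumes "x \<in> X" "y \<in> Y"
  shows "x \<cdot> y \<in> product_span X Y" and "bracket x y \<in> product_span X Y"
  using product_span_subset_iff[OF subspace_product_spans(3), of X Y X Y] assms by auto

lemma product_span_mono: "X \<subseteq> X' \<Longrightarrow> Y \<subseteq> Y' \<Longrightarrow> product_span X Y \<subseteq> product_span X' Y'"
  by (auto simp: product_span_subset_iff[OF subspace_product_spans(3)] intro: product_spanI)

lemma ideal_iff: "ideal I \<longleftrightarrow> subspace I \<and> (\<forall>x\<in>I. \<forall>y. x \<cdot> y \<in> I \<and> bracket x y \<in> I)"
  unfolding ideal_def using product_span_subset_iff[of I I UNIV]
  by (auto simp: product_span_def)

lemma ideal_subspace: "ideal I \<Longrightarrow> subspace I"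
  by (simp add: ideal_iff)

lemma ideal_closed:
  assumes "ideal I" "x \<in> I"
  shows "x \<cdot> y \<in> I" "y \<cdot> x \<in> I" "bracket x y \<in> I" "bracket y x \<in> I"
proof -
  show *: "x \<cdot> y \<in> I" "bracket x y \<in> I" using assms by (auto simp: ideal_iff)
  show "y \<cdot> x \<in> I" using * by (simp add: mult_commute)
  show "bracket y x \<in> I"
    using * subspace_neg[OF ideal_subspace[OF assms(1)]] by (subst bracket_skew) blast
qed

lemma ideal_plus:
  assumes "ideal I" "ideal J"
  shows "ideal (I + J)"
  unfolding ideal_iff
proof (intro conjI ballI allI)
  show "subspace (I + J)" using assms by (simp add: ideal_subspace subspace_plus)
  fix x y assume "x \<in> I + J"
  then obtain u v where "x = u + v" "u \<in> I" "v \<in> J" by (rule set_plus_elim)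
  then show "x \<cdot> y \<in> I + J" "bracket x y \<in> I + J"
    using assms by (simp_all add: mult_add_left bracket_add_left set_plus_intro ideal_closed)
qed

lemma ideal_mult_span:
  assumes I: "ideal I" and J: "ideal J"
  shows "ideal (mult_span I J)"
proof -
  let ?M = "mult_span I J"
  have sub: "subspace ?M" by (rule subspace_product_spans)
  have in_M: "a \<cdot> c \<in> ?M" if "a \<in> I" "c \<in> J" for a c
    using that mult_span_subset_iff[OF sub] by blast
  have "?M \<subseteq> {z. z \<cdot> y \<in> ?M \<and> bracket z y \<in> ?M}" (is "_ \<subseteq> ?Z") for y
  proof -
    have "subspace ?Z"
      by (rule subspaceI) (auto simp: bilinear subspace_0[OF sub] subspace_add[OF sub] subspace_scale[OF sub])
    moreover have "a \<cdot> c \<in> ?Z" if "a \<in> I" "c \<in> J" for a c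
      using that in_M ideal_closed[OF I] ideal_closed[OF J]
      by (auto simp: mult_assoc leibniz intro!: subspace_add[OF sub])
    ultimately show ?thesis using mult_span_subset_iff[of ?Z I J] by blast
  qed
  then show ?thesis using sub by (auto simp: ideal_iff)
qed

text \<open>For the elements \<open>bracket a c \<cdot> y\<close> the Leibniz rule is read backwards: they equal
  \<open>bracket (a \<cdot> y) c - a \<cdot> bracket y c\<close>.\<close>

lemma ideal_product_span:
  assumes I: "ideal I" and J: "ideal J"
  shows "ideal (product_span I J)"
proof -
  let ?M = "product_span I J"
  have sub: "subspace ?M" by (rule subspace_product_spans)
  have "?M \<subseteq> {z. z \<cdot> y \<in> ?M \<and> bracket z y \<in> ?M}" (is "_ \<subseteq> ?Z") for y
  proof -
    have "subspace ?Z"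
      by (rule subspaceI) (auto simp: bilinear subspace_0[OF sub] subspace_add[OF sub] subspace_scale[OF sub])
    moreover have "a \<cdot> c \<in> ?Z" "bracket a c \<in> ?Z" if "a \<in> I" "c \<in> J" for a c
    proof -
      note closed = that ideal_closed[OF I] ideal_closed[OF J]
      show "a \<cdot> c \<in> ?Z"
        using closed by (auto simp: mult_assoc leibniz intro!: product_spanI subspace_add[OF sub])
      have "bracket a c \<cdot> y = bracket (a \<cdot> y) c - a \<cdot> bracket y c"
        by (simp add: leibniz)
      moreover have "bracket (bracket a c) y = bracket a (bracket c y) - bracket c (bracket a y)"
        by (simp add: jacobi_derivation[of a c y])
      moreover have "bracket c (bracket a y) = - bracket (bracket a y) c"
        by (rule bracket_skew)
      ultimately show "bracket a c \<in> ?Z"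
        using closed by (auto intro!: product_spanI subspace_diff[OF sub] subspace_add[OF sub])
    qed
    ultimately show ?thesis using product_span_subset_iff[of ?Z I J] by blast
  qed
  then show ?thesis using sub by (auto simp: ideal_iff)
qed

lemma bracket_span_invariant:
  assumes X: "ideal X" and Y: "ideal Y" and b: "b \<in> bracket_span X Y"
  shows "bracket y b \<in> bracket_span X Y"
proof -
  let ?M = "bracket_span X Y"
  have sub: "subspace ?M" by (rule subspace_product_spans)
  have in_M: "bracket s t \<in> ?M" if "s \<in> X" "t \<in> Y" for s t
    using that bracket_span_subset_iff[OF sub] by blast
  have U: "subspace {b. bracket y b \<in> ?M}"
    by (rule subspaceI)
      (auto simp: bilinear subspace_0[OF sub] subspace_add[OF sub] subspace_scale[OF sub])
  have "bracket y (bracket s t) \<in> ?M" if "s \<in> X" "t \<in> Y" for s t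
    unfolding jacobi_derivation[of y]
    using that by (intro subspace_add[OF sub] in_M ideal_closed(4)[OF X] ideal_closed(4)[OF Y])
  then have "?M \<subseteq> {b. bracket y b \<in> ?M}"
    by (simp add: bracket_span_subset_iff[OF U])
  then show ?thesis using b by blast
qed

lemma ideal_zero: "ideal {0}" and ideal_UNIV: "ideal UNIV"
  by (auto simp: ideal_iff bilinear)

lemma ideal_derived: "ideal I \<Longrightarrow> ideal (derived I n)"
  by (induction n) (simp_all add: square_eq_product_span ideal_product_span)

lemma derived_antimono: "ideal I \<Longrightarrow> derived I n \<subseteq> I"
proof (induction n)
  case (Suc n)
  have "ideal (derived I n)" by (rule ideal_derived) fact
  then have "square (derived I n) \<subseteq> derived I n"
    unfolding square_eq_product_span
    by (subst product_span_subset_iff) (auto simp: ideal_subspace ideal_closed)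
  then show ?case using Suc by auto
qed simp

lemma derived_mono: "A \<subseteq> B \<Longrightarrow> derived A n \<subseteq> derived B n"
  by (induction n) (simp_all add: square_eq_product_span product_span_mono)

lemma derived_derived: "derived (derived A m) n = derived A (m + n)"
  by (induction n) simp_all

text \<open>Modulo \<open>J\<close>, the derived series of \<open>I + J\<close> is that of \<open>I\<close>, so it reaches \<open>J\<close> and then
  descends inside the derived series of \<open>J\<close>.\<close>

lemma solvable_plus:
  assumes I: "ideal I" "solvable I" and J: "ideal J" "solvable J"
  shows "solvable (I + J)"
proof -
  obtain m n where m: "derived I m = {0}" and n: "derived J n = {0}"
    using I(2) J(2) unfolding solvable_def by blast
  have le: "derived (I + J) k \<subseteq> derived I k + J" for k
  proof (induction k)
    case (Suc k)
    let ?D = "derived I k" and ?Z = "derived I (Suc k) + J"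
    have Z: "subspace ?Z"
      by (intro subspace_plus ideal_subspace ideal_derived I J)
    have "(x + u) \<cdot> (y + v) \<in> ?Z \<and> bracket (x + u) (y + v) \<in> ?Z"
      if "x \<in> ?D" "y \<in> ?D" "u \<in> J" "v \<in> J" for x y u v
    proof -
      have "(x + u) \<cdot> (y + v) = x \<cdot> y + (x \<cdot> v + u \<cdot> (y + v))"
        by (simp add: bilinear add_ac)
      moreover have "bracket (x + u) (y + v) = bracket x y + (bracket x v + bracket u (y + v))"
        by (simp add: bilinear add_ac)
      moreover have "x \<cdot> v + u \<cdot> (y + v) \<in> J" "bracket x v + bracket u (y + v) \<in> J"
        using that
        by (simp_all add: subspace_add[OF ideal_subspace[OF J(1)]] ideal_closed[OF J(1)])
      moreover have "x \<cdot> y \<in> derived I (Suc k)" "bracket x y \<in> derived I (Suc k)"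
        using that by (simp_all add: square_eq_product_span product_spanI)
      ultimately show ?thesis by (metis set_plus_intro)
    qed
    then have "product_span (?D + J) (?D + J) \<subseteq> ?Z"
      by (subst product_span_subset_iff[OF Z]) (auto simp: set_plus_def)
    then show ?case
      using product_span_mono[OF Suc Suc] by (simp add: square_eq_product_span)
  qed simp
  have "derived (I + J) (m + n) \<subseteq> {0}"
    using derived_mono[of "derived (I + J) m" J n] le[of m] m n
    by (simp add: derived_derived)
  moreover have "0 \<in> derived (I + J) (m + n)"
    by (intro subspace_0 ideal_subspace ideal_derived ideal_plus I J)
  ultimately show ?thesis unfolding solvable_def by blast
qed

text \<open>A solvable ideal of maximal dimension contains every other one, since the sum of the two is
  again solvable.\<close>

lemma radical_solvable_ideal:
  assumes "finite_dimensional_vector_space scale Basis"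
  shows "ideal radical \<and> solvable radical"
proof -
  interpret finite_dimensional_vector_space scale Basis by fact
  let ?Q = "\<lambda>I. ideal I \<and> solvable I"
  have "?Q {0}"
    unfolding solvable_def by (auto simp: ideal_zero intro!: exI[of _ 0])
  moreover have "subspace I" if "?Q I" for I using that ideal_subspace by blast
  ultimately obtain I where I: "?Q I" and max: "\<And>J. ?Q J \<Longrightarrow> I \<subseteq> J \<Longrightarrow> J = I"
    using subspace_of_maximal_dim[of ?Q "{0}"] by blast
  have "J \<subseteq> I" if J: "ideal J \<and> solvable J" for J
  proof -
    have "I \<subseteq> I + J \<and> J \<subseteq> I + J"
      using plus_subset_subspace_iff[of "I + J" I J] I J
      by (simp add: ideal_subspace subspace_plus)
    moreover have "ideal (I + J) \<and> solvable (I + J)"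
      using I J by (simp add: ideal_plus solvable_plus)
    ultimately show ?thesis using max by blast
  qed
  then have "radical = I"
    unfolding radical_def using I by (intro Greatest_equality) auto
  then show ?thesis using I by simp
qed

section \<open>Right-normed products\<close>

text \<open>Indices are shifted: \<open>lower_central A n\<close> is spanned by the right-normed products of \<open>n + 1\<close>
  factors from \<open>A\<close>.\<close>

definition lower_central :: "'p set \<Rightarrow> nat \<Rightarrow> 'p set" where
  "lower_central A n = (product_span A ^^ n) A"

lemma lower_central_Suc: "lower_central A (Suc n) = product_span A (lower_central A n)"
  by (simp add: lower_central_def)

lemma subspace_lower_central: "subspace A \<Longrightarrow> subspace (lower_central A n)"
  by (cases n) (simp_all add: lower_central_def subspace_product_spans)

text \<open>The product of a right-normed product with anything is expanded by associativity, the Leibniz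
  rule and the Jacobi identity until its outermost factor from \<open>A\<close> stands in front. In
  \<open>bracket a c \<cdot> d = bracket a (c \<cdot> d) - c \<cdot> bracket a d\<close>, for instance, the second term
  has a shorter left factor, hence the induction on \<open>i\<close> for all \<open>j\<close>.\<close>

lemma product_span_lower_central:
  assumes A: "subspace A"
  shows "product_span (lower_central A i) (lower_central A j) \<subseteq> lower_central A (Suc (i + j))"
proof (induction i arbitrary: j)
  case 0
  then show ?case by (simp add: lower_central_def)
next
  case (Suc i)
  let ?C = "lower_central A" and ?Z = "lower_central A (Suc (Suc (i + j)))"
  have sub: "subspace ?Z" by (rule subspace_lower_central[OF A])
  have step: "a \<cdot> c \<in> ?C (Suc k)" "bracket a c \<in> ?C (Suc k)" if "a \<in> A" "c \<in> ?C k" for a c k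
    using that by (simp_all add: lower_central_Suc product_spanI)
  have IH: "c \<cdot> d \<in> ?C (Suc (i + k))" "bracket c d \<in> ?C (Suc (i + k))"
    if "c \<in> ?C i" "d \<in> ?C k" for c d k
    using Suc[of k] product_spanI[OF that] by auto
  have "?C (Suc i) \<subseteq> {z. z \<cdot> d \<in> ?Z \<and> bracket z d \<in> ?Z}" (is "_ \<subseteq> ?U") if d: "d \<in> ?C j" for d
  proof -
    have "subspace ?U"
      by (rule subspaceI) (auto simp: bilinear subspace_0[OF sub] subspace_add[OF sub] subspace_scale[OF sub])
    moreover have "a \<cdot> c \<in> ?U" "bracket a c \<in> ?U" if "a \<in> A" "c \<in> ?C i" for a c
    proof -
      have c_ad: "c \<cdot> bracket a d \<in> ?Z" "bracket c (bracket a d) \<in> ?Z"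
        using IH[of c "bracket a d" "Suc j"] step[of a d j] that d by simp_all
      have a_cd: "a \<cdot> (c \<cdot> d) \<in> ?Z" "bracket a (c \<cdot> d) \<in> ?Z"
        "a \<cdot> bracket c d \<in> ?Z" "bracket a (bracket c d) \<in> ?Z"
        using step IH that d by blast+
      show "a \<cdot> c \<in> ?U"
        using c_ad a_cd mult_commute[of c "bracket a d"]
        by (auto simp: mult_assoc leibniz intro!: subspace_add[OF sub])
      have "bracket a c \<cdot> d = bracket a (c \<cdot> d) - c \<cdot> bracket a d"
        by (simp add: leibniz_right)
      moreover have "bracket (bracket a c) d = bracket a (bracket c d) - bracket c (bracket a d)"
        by (simp add: jacobi_derivation[of a c d])
      ultimately show "bracket a c \<in> ?U"
        using c_ad a_cd by (auto intro!: subspace_diff[OF sub])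
    qed
    ultimately have "product_span A (?C i) \<subseteq> ?U"
      using product_span_subset_iff[of ?U] by blast
    then show ?thesis by (simp only: lower_central_Suc[of A i])
  qed
  then show ?case by (auto simp: product_span_subset_iff[OF sub])
qed

lemma sum_subset_subspace:
  fixes X :: "'i \<Rightarrow> 'p set"
  assumes "subspace Z" "\<And>i. i \<in> S \<Longrightarrow> X i \<subseteq> Z"
  shows "sum X S \<subseteq> Z"
  using assms(2)
proof (induction S rule: infinite_finite_induct)
  case (insert i S)
  then have "X i \<subseteq> Z" "sum X S \<subseteq> Z" by auto
  then have "X i + sum X S \<subseteq> Z"
    using assms(1) by (auto simp: set_plus_def intro!: subspace_add)
  then show ?case using insert by simp
qed (use subspace_0[OF assms(1)] in \<open>auto simp: set_zero\<close>)

lemma zero_in_sum: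
  fixes X :: "'i \<Rightarrow> 'p set"
  assumes "\<And>i. i \<in> S \<Longrightarrow> 0 \<in> X i"
  shows "0 \<in> sum X S"
  using assms
proof (induction S rule: infinite_finite_induct)
  case (insert i S)
  then have "0 + 0 \<in> X i + sum X S" by (intro set_plus_intro) auto
  then show ?case using insert by simp
qed (auto simp: set_zero)

lemma pow_Suc_Suc:
  "pow A (Suc (Suc n)) = (\<Sum>i = 1..Suc n. product_span (pow A i) (pow A (Suc (Suc n) - i)))"
  by (simp only: pow.simps product_span_def)

lemma pow_subset_lower_central:
  assumes A: "subspace A"
  shows "pow A (Suc n) \<subseteq> lower_central A n"
proof (induction n rule: less_induct)
  case (less n)
  show ?case
  proof (cases n)
    case 0
    then show ?thesis by (simp add: lower_central_def)
  next
    case (Suc k)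
    have "product_span (pow A i) (pow A (Suc (Suc k) - i)) \<subseteq> lower_central A n"
      if i: "i \<in> {1..Suc k}" for i
    proof -
      obtain j where j: "i = Suc j" "j \<le> k" using i by (cases i) auto
      have "pow A i \<subseteq> lower_central A j" using less[of j] j Suc by simp
      moreover have "pow A (Suc (Suc k) - i) \<subseteq> lower_central A (k - j)"
        using less[of "k - j"] j Suc by (simp add: Suc_diff_le)
      ultimately have "product_span (pow A i) (pow A (Suc (Suc k) - i))
          \<subseteq> product_span (lower_central A j) (lower_central A (k - j))"
        by (rule product_span_mono)
      also have "\<dots> \<subseteq> lower_central A n"
        using product_span_lower_central[OF A, of j "k - j"] j Suc by simp
      finally show ?thesis .
    qed
    then have "(\<Sum>i = 1..Suc k. product_span (pow A i) (pow A (Suc (Suc k) - i)))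
        \<subseteq> lower_central A n"
      by (intro sum_subset_subspace subspace_lower_central A)
    then show ?thesis unfolding Suc pow_Suc_Suc .
  qed
qed

lemma nilpotent_if_lower_central_zero:
  assumes A: "subspace A" and "lower_central A n \<subseteq> {0}"
  shows "nilpotent A"
proof -
  have "0 \<in> pow A (Suc n)"
  proof (cases n)
    case 0
    then show ?thesis using subspace_0[OF A] by simp
  next
    case (Suc k)
    have "0 \<in> (\<Sum>i = 1..Suc k. product_span (pow A i) (pow A (Suc (Suc k) - i)))"
      by (intro zero_in_sum subspace_0 subspace_product_spans)
    then show ?thesis unfolding Suc pow_Suc_Suc .
  qed
  then have "pow A (Suc n) = {0}"
    using pow_subset_lower_central[OF A, of n] assms(2) by blast
  then show ?thesis unfolding nilpotent_def by (intro exI[of _ "Suc n"]) simp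
qed

end

section \<open>Action on chief factors\<close>

text \<open>The quotient \<open>W / W'\<close> itself is never formed: operators on it are operators on \<open>W\<close>,
  compared modulo \<open>W'\<close>.\<close>

locale chief_factor = poisson_algebra scale mult bracket
  for scale :: "'f::field \<Rightarrow> 'p::ab_group_add \<Rightarrow> 'p"
    and mult :: "'p \<Rightarrow> 'p \<Rightarrow> 'p"  (infixl \<open>\<cdot>\<close> 70)
    and bracket :: "'p \<Rightarrow> 'p \<Rightarrow> 'p" +
  fixes W W' :: "'p set"
  assumes ideal_W: "ideal W" and ideal_W': "ideal W'" and proper: "W' \<subset> W"
    and chief: "ideal U \<Longrightarrow> W' \<subseteq> U \<Longrightarrow> U \<subseteq> W \<Longrightarrow> U = W' \<or> U = W"
begin

lemmas closed_W = ideal_closed[OF ideal_W] and closed_W' = ideal_closed[OF ideal_W']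
lemmas sub_W = ideal_subspace[OF ideal_W] and sub_W' = ideal_subspace[OF ideal_W']

text \<open>Otherwise \<open>W = I \<cdot> W + W'\<close>; substituting this into itself gives
  \<open>W = D \<cdot> W + W'\<close> for every term \<open>D\<close> of the derived series of \<open>I\<close>, hence \<open>W = W'\<close>.\<close>

lemma solvable_ideal_mult_trivial:
  assumes I: "ideal I" "solvable I" and x: "x \<in> I" and w: "w \<in> W"
  shows "x \<cdot> w \<in> W'"
proof (rule ccontr)
  assume notin: "x \<cdot> w \<notin> W'"
  have sub: "subspace (mult_span X W)" for X by (rule subspace_product_spans)
  have in_span: "a \<cdot> v \<in> mult_span X W" if "a \<in> X" "v \<in> W" for a v X
    using that mult_span_subset_iff[OF sub] by blast
  have sub': "subspace (mult_span X W + W')" for X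
    by (intro subspace_plus sub sub_W')
  have le: "mult_span X W \<subseteq> mult_span X W + W'" "W' \<subseteq> mult_span X W + W'" for X
    using plus_subset_subspace_iff[OF sub' sub sub_W'] by blast+
  have "mult_span I W \<subseteq> W"
    by (subst mult_span_subset_iff) (auto simp: sub_W closed_W)
  then have "mult_span I W + W' \<subseteq> W"
    using plus_subset_subspace_iff[OF sub_W sub sub_W'] proper by blast
  moreover have "mult_span I W + W' \<noteq> W'"
    using notin in_span[OF x w] le(1) by blast
  ultimately have eq: "mult_span I W + W' = W"
    using chief[of "mult_span I W + W'"] le(2) ideal_plus[OF ideal_mult_span[OF I(1) ideal_W] ideal_W']
    by blast
  have all: "W \<subseteq> mult_span (derived I n) W + W'" for n
  proof (induction n)
    case 0
    show ?case using eq by simp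
  next
    case (Suc n)
    let ?Z = "mult_span (derived I (Suc n)) W + W'"
    have "a \<cdot> v \<in> ?Z" if a: "a \<in> derived I n" and v: "v \<in> W" for a v
    proof -
      have "W \<subseteq> {v. a \<cdot> v \<in> ?Z}" (is "_ \<subseteq> ?U")
      proof -
        have U: "subspace ?U"
          by (rule subspaceI)
            (auto simp: bilinear subspace_0[OF sub'] subspace_add[OF sub'] subspace_scale[OF sub'])
        have "c \<cdot> u \<in> ?U" if c: "c \<in> derived I n" and u: "u \<in> W" for c u
        proof -
          have "a \<cdot> c \<in> derived I (Suc n)"
            using a c by (simp add: square_eq_product_span product_spanI)
          then have "(a \<cdot> c) \<cdot> u \<in> ?Z" using in_span u le(1) by blast
          then show ?thesis by (simp add: mult_assoc)
        qed
        then have "mult_span (derived I n) W \<subseteq> ?U"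
          by (subst mult_span_subset_iff[OF U]) blast
        moreover have "W' \<subseteq> ?U" using closed_W' le(2) by blast
        ultimately have "mult_span (derived I n) W + W' \<subseteq> ?U"
          using plus_subset_subspace_iff[OF U sub sub_W'] by blast
        then show ?thesis using Suc by blast
      qed
      then show ?thesis using v by blast
    qed
    then have "mult_span (derived I n) W \<subseteq> ?Z"
      by (subst mult_span_subset_iff[OF sub']) blast
    then have "mult_span (derived I n) W + W' \<subseteq> ?Z"
      using plus_subset_subspace_iff[OF sub' sub sub_W'] le(2) by blast
    then show ?case using Suc by blast
  qed
  obtain m where m: "derived I m = {0}" using I(2) unfolding solvable_def by blast
  have "mult_span {0} W \<subseteq> {0}" by (subst mult_span_subset_iff) (auto simp: bilinear)
  then have "mult_span {0} W + W' \<subseteq> W'"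
    using plus_subset_subspace_iff[OF sub_W' sub sub_W'] subspace_0[OF sub_W'] by blast
  then show False using all[of m] m proper by auto
qed

lemma power_bracket_closed:
  "w \<in> W \<Longrightarrow> (bracket b ^^ n) w \<in> W" "w \<in> W' \<Longrightarrow> (bracket b ^^ n) w \<in> W'"
  by (induction n) (auto simp: closed_W closed_W')

lemma power_bracket_diff: "(bracket b ^^ n) (u - v) = (bracket b ^^ n) u - (bracket b ^^ n) v"
  by (induction n) (auto simp: bracket_diff_right)

text \<open>If \<open>b\<close> commutes modulo \<open>W'\<close> with \<open>bracket y b\<close> for all \<open>y\<close>, then
  \<open>b\<^sup>n y \<equiv> y b\<^sup>n - n b\<^sup>n\<^sup>-\<^sup>1 (bracket y b)\<close>, so the generalised kernel of \<open>b\<close> on \<open>W / W'\<close> is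
  closed under brackets. It is closed under multiplication because \<open>b\<close> commutes modulo \<open>W'\<close> with
  multiplication by \<open>y\<close>, their commutator being multiplication by \<open>bracket b y\<close>. Hence it is an
  ideal, either \<open>W\<close> or \<open>W'\<close>.\<close>

lemma locally_nilpotent_or_injective:
  assumes mult_b: "\<And>y w. w \<in> W \<Longrightarrow> bracket b y \<cdot> w \<in> W'"
    and comm: "\<And>y w. w \<in> W \<Longrightarrow> bracket (bracket b (bracket y b)) w \<in> W'"
  shows "(\<forall>w\<in>W. \<exists>n. (bracket b ^^ n) w \<in> W') \<or> (\<forall>w\<in>W. bracket b w \<in> W' \<longrightarrow> w \<in> W')"
proof -
  define G where "G = {w \<in> W. \<exists>n. (bracket b ^^ n) w \<in> W'}"
  have stay: "(bracket b ^^ (k + n)) w \<in> W'" if "(bracket b ^^ n) w \<in> W'" for k n w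
    using that by (simp add: funpow_add power_bracket_closed)
  have power_add: "(bracket b ^^ n) (u + v) = (bracket b ^^ n) u + (bracket b ^^ n) v" for n u v
    by (induction n) (auto simp: bilinear)
  have power_scale: "(bracket b ^^ n) (scale c u) = scale c ((bracket b ^^ n) u)" for n c u
    by (induction n) (auto simp: bilinear)
  have sub: "subspace G"
  proof (rule subspaceI)
    show "0 \<in> G"
      using subspace_0[OF sub_W] subspace_0[OF sub_W'] by (auto simp: G_def intro!: exI[of _ 0])
  next
    fix u v assume "u \<in> G" "v \<in> G"
    then obtain m n where "u \<in> W" "v \<in> W" "(bracket b ^^ m) u \<in> W'" "(bracket b ^^ n) v \<in> W'"
      unfolding G_def by blast
    then show "u + v \<in> G"
      using stay[of m u n] stay[of n v m]
      by (auto simp: G_def power_add add.commute subspace_add sub_W sub_W' intro!: exI[of _ "m + n"])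
  next
    fix c u assume "u \<in> G"
    then obtain n where "u \<in> W" "(bracket b ^^ n) u \<in> W'" unfolding G_def by blast
    then have "scale c u \<in> W" "(bracket b ^^ n) (scale c u) \<in> W'"
      by (simp_all add: power_scale subspace_scale sub_W sub_W')
    then show "scale c u \<in> G" unfolding G_def by blast
  qed
  have commute_power: "(bracket b ^^ n) (bracket (bracket y b) w) - bracket (bracket y b) ((bracket b ^^ n) w) \<in> W'"
    if "w \<in> W" for n y w
  proof (induction n)
    case (Suc n)
    let ?c = "bracket y b" and ?u = "(bracket b ^^ n) w"
    have "bracket b (bracket ?c ?u) = bracket (bracket b ?c) ?u + bracket ?c (bracket b ?u)"
      by (rule jacobi_derivation)
    then have "(bracket b ^^ Suc n) (bracket ?c w) - bracket ?c ((bracket b ^^ Suc n) w)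
        = bracket b ((bracket b ^^ n) (bracket ?c w) - bracket ?c ?u) + bracket (bracket b ?c) ?u"
      by (simp add: bracket_diff_right)
    then show ?case
      using Suc comm[OF power_bracket_closed(1)[OF that]]
      by (simp add: subspace_add[OF sub_W'] closed_W')
  qed (simp add: subspace_0[OF sub_W'])
  have bracket_G: "(bracket b ^^ Suc n) (bracket y w) \<in> W'"
    if "w \<in> W" "(bracket b ^^ n) w \<in> W'" for n y w
    using that
  proof (induction n arbitrary: w)
    case 0
    then show ?case by (simp add: closed_W')
  next
    case (Suc n)
    let ?c = "bracket y b"
    have "(bracket b ^^ Suc n) (bracket y (bracket b w)) \<in> W'"
      using Suc.prems by (intro Suc.IH) (simp_all add: closed_W funpow_swap1)
    moreover have "(bracket b ^^ Suc n) (bracket ?c w) \<in> W'"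
    proof -
      have "bracket ?c ((bracket b ^^ Suc n) w) \<in> W'"
        using Suc.prems by (simp add: closed_W')
      then show ?thesis
        using subspace_add[OF sub_W' commute_power[OF Suc.prems(1), of "Suc n" y]] by fastforce
    qed
    ultimately have "(bracket b ^^ Suc n) (bracket y (bracket b w) - bracket ?c w) \<in> W'"
      by (simp only: power_bracket_diff subspace_diff[OF sub_W'])
    moreover have "bracket b (bracket y w) = bracket y (bracket b w) - bracket ?c w"
      by (simp add: jacobi_derivation[of y b w])
    ultimately have "(bracket b ^^ Suc n) (bracket b (bracket y w)) \<in> W'" by simp
    then show ?case by (simp add: funpow_swap1)
  qed
  have mult_power: "(bracket b ^^ n) (y \<cdot> w) - y \<cdot> (bracket b ^^ n) w \<in> W'" if "w \<in> W" for n y w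
  proof (induction n)
    case (Suc n)
    let ?u = "(bracket b ^^ n) w"
    have "(bracket b ^^ Suc n) (y \<cdot> w) - y \<cdot> (bracket b ^^ Suc n) w
        = bracket b ((bracket b ^^ n) (y \<cdot> w) - y \<cdot> ?u) + bracket b y \<cdot> ?u"
      by (simp add: bracket_diff_right leibniz_right)
    then show ?case
      using Suc mult_b[OF power_bracket_closed(1)[OF that]]
      by (simp add: subspace_add[OF sub_W'] closed_W')
  qed (simp add: subspace_0[OF sub_W'])
  have mult_G: "(bracket b ^^ n) (y \<cdot> w) \<in> W'" if "w \<in> W" "(bracket b ^^ n) w \<in> W'" for n y w
    using subspace_add[OF sub_W' mult_power[OF that(1), of n y]] closed_W'(2)[OF that(2), of y]
    by fastforce
  have "ideal G"
    unfolding ideal_iff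
  proof (intro conjI ballI allI sub)
    fix w y assume "w \<in> G"
    then obtain n where w: "w \<in> W" "(bracket b ^^ n) w \<in> W'" unfolding G_def by blast
    then show "w \<cdot> y \<in> G"
      using mult_G[OF w, of y] by (auto simp: G_def closed_W mult_commute)
    have "bracket y w \<in> G"
      using bracket_G[OF w, of y] w(1) by (auto simp: G_def closed_W simp del: funpow.simps)
    then show "bracket w y \<in> G"
      using subspace_neg[OF sub] by (subst bracket_skew) blast
  qed
  moreover have "W' \<subseteq> G" using proper by (auto simp: G_def intro!: exI[of _ 0])
  moreover have "G \<subseteq> W" by (auto simp: G_def)
  ultimately consider "G = W" | "G = W'" using chief by blast
  then show ?thesis
  proof cases
    case 1
    then show ?thesis by (auto simp: G_def)
  next
    case 2
    have "w \<in> G" if "w \<in> W" "bracket b w \<in> W'" for w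
      using that by (auto simp: G_def intro!: exI[of _ 1])
    then show ?thesis using 2 by blast
  qed
qed

text \<open>If \<open>w\<close> is killed by all operators but \<open>c\<close>, then so are the iterates of \<open>c\<close> on \<open>w\<close>, and the
  last of them outside \<open>W'\<close> is killed by \<open>c\<close> as well.\<close>

lemma common_kernel_vector:
  assumes "finite B"
    and nil: "\<And>b w. b \<in> B \<Longrightarrow> w \<in> W \<Longrightarrow> \<exists>n. (bracket b ^^ n) w \<in> W'"
    and comm: "\<And>b c w. b \<in> B \<Longrightarrow> c \<in> B \<Longrightarrow> w \<in> W \<Longrightarrow> bracket (bracket b c) w \<in> W'"
  shows "\<exists>w\<in>W - W'. \<forall>b\<in>B. bracket b w \<in> W'"
  using assms
proof (induction B)
  case empty
  then show ?case using proper by blast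
next
  case (insert c B)
  have "\<exists>w\<in>W - W'. \<forall>b\<in>B. bracket b w \<in> W'"
    by (rule insert.IH) (use insert.prems in blast)+
  then obtain w where w: "w \<in> W" "w \<notin> W'" "\<forall>b\<in>B. bracket b w \<in> W'" by blast
  have stay: "(bracket c ^^ n) w \<in> W" for n
    by (rule power_bracket_closed(1)) (rule w(1))
  have kill: "bracket b ((bracket c ^^ n) w) \<in> W'" if b: "b \<in> B" for b n
  proof (induction n)
    case 0
    then show ?case using w b by simp
  next
    case (Suc n)
    let ?u = "(bracket c ^^ n) w"
    have "bracket b (bracket c ?u) = bracket (bracket b c) ?u + bracket c (bracket b ?u)"
      by (rule jacobi_derivation)
    moreover have "bracket (bracket b c) ?u \<in> W'"
      by (rule insert.prems(2)) (use b stay in simp_all)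
    moreover have "bracket c (bracket b ?u) \<in> W'"
      using Suc by (rule closed_W')
    ultimately show ?case by (simp add: subspace_add[OF sub_W'])
  qed
  define n where "n = (LEAST n. (bracket c ^^ n) w \<in> W')"
  have "\<exists>n. (bracket c ^^ n) w \<in> W'"
    by (rule insert.prems(1)) (use w in simp_all)
  then have n: "(bracket c ^^ n) w \<in> W'"
    unfolding n_def by (rule LeastI_ex)
  then obtain k where k: "n = Suc k" using w(2) by (cases n) auto
  have "(bracket c ^^ k) w \<notin> W'"
    using not_less_Least[of k "\<lambda>n. (bracket c ^^ n) w \<in> W'"] k unfolding n_def by simp
  then show ?case
    using kill[of _ k] n k stay[of k] by (intro bexI[of _ "(bracket c ^^ k) w"]) auto
qed

lemma poly_action_bracket_closed:
  assumes "w \<in> W"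
  shows "poly_action scale (bracket a) q w \<in> W"
proof (induction q)
  case 0
  show ?case by (simp add: ad.poly_action_0 subspace_0[OF sub_W])
next
  case (pCons c q)
  then show ?case using assms
    by (simp add: ad.poly_action_pCons subspace_add[OF sub_W]
        subspace_scale[OF sub_W] closed_W)
qed

text \<open>If \<open>a\<close> commutes with \<open>bracket x a\<close>, then commuting with \<open>x\<close> acts on polynomials in \<open>a\<close>
  as the derivation \<open>q \<mapsto> q' (bracket x a)\<close>.\<close>

lemma bracket_poly_action:
  assumes comm: "\<And>w. w \<in> W \<Longrightarrow> bracket (bracket (bracket x a) a) w \<in> W'" and w: "w \<in> W"
  shows "bracket x (poly_action scale (bracket a) q w) - poly_action scale (bracket a) q (bracket x w)
    - bracket (bracket x a) (poly_action scale (bracket a) (pderiv q) w) \<in> W'"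
proof (induction q)
  case 0
  show ?case by (simp add: ad.poly_action_0 bilinear subspace_0[OF sub_W'])
next
  case (pCons c q)
  let ?p = "poly_action scale (bracket a)" and ?b = "bracket x a"
  let ?e = "bracket x (?p q w) - ?p q (bracket x w) - bracket ?b (?p (pderiv q) w)"
  note simps = ad.poly_action_pCons ad.poly_action_add
  have 1: "bracket x (bracket a (?p q w)) = bracket ?b (?p q w) + bracket a (bracket x (?p q w))"
    by (rule jacobi_derivation)
  have 2: "bracket ?b (bracket a (?p (pderiv q) w))
      = bracket (bracket ?b a) (?p (pderiv q) w) + bracket a (bracket ?b (?p (pderiv q) w))"
    by (rule jacobi_derivation)
  have "bracket x (?p (pCons c q) w) - ?p (pCons c q) (bracket x w)
      - bracket ?b (?p (pderiv (pCons c q)) w)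
      = bracket a ?e - bracket (bracket ?b a) (?p (pderiv q) w)"
    by (simp add: pderiv_pCons simps bilinear 1 2 bracket_diff_right algebra_simps)
  then show ?case
    using pCons.IH comm[OF poly_action_bracket_closed[OF w]]
    by (simp add: subspace_diff[OF sub_W'] closed_W')
qed

end

locale finite_dimensional_chief_factor =
  chief_factor scale mult bracket W W' + finite_dimensional_vector_space scale Basis
  for scale :: "'f::field_char_0 \<Rightarrow> 'p::ab_group_add \<Rightarrow> 'p"
    and mult :: "'p \<Rightarrow> 'p \<Rightarrow> 'p"  (infixl \<open>\<cdot>\<close> 70)
    and bracket :: "'p \<Rightarrow> 'p \<Rightarrow> 'p"
    and W W' Basis :: "'p set"
begin

text \<open>Take a non-zero \<open>q\<close> of least degree such that \<open>q(a)\<close> vanishes on \<open>W / W'\<close>. Then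
  \<open>b q'(a)\<close> vanishes as well, so \<open>q'(a)\<close> does if \<open>b\<close> is injective. In characteristic zero this
  contradicts minimality, unless \<open>q\<close> is constant, and then \<open>W = W'\<close>.\<close>

lemma commutator_not_injective:
  assumes comm: "\<And>w. w \<in> W \<Longrightarrow> bracket (bracket (bracket x a) a) w \<in> W'"
  shows "\<not> (\<forall>w\<in>W. bracket (bracket x a) w \<in> W' \<longrightarrow> w \<in> W')"
proof
  assume inj: "\<forall>w\<in>W. bracket (bracket x a) w \<in> W' \<longrightarrow> w \<in> W'"
  let ?p = "poly_action scale (bracket a)" and ?b = "bracket x a"
  define Q where "Q q \<longleftrightarrow> q \<noteq> 0 \<and> (\<forall>w\<in>W. ?p q w \<in> W')" for q
  have "\<exists>q. Q q"
    unfolding Q_def using poly_annihilating_endomorphism[OF ad.vector_space_endomorphism_axioms, of a]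
      subspace_0[OF sub_W'] by metis
  then obtain q where q: "Q q" and min: "\<And>r. Q r \<Longrightarrow> degree q \<le> degree r"
    using ex_has_least_nat[of Q _ degree] by blast
  have "?p (pderiv q) w \<in> W'" if w: "w \<in> W" for w
  proof -
    have "bracket x (?p q w) - ?p q (bracket x w) \<in> W'"
      using q w unfolding Q_def by (simp add: closed_W closed_W' subspace_diff[OF sub_W'])
    then have "bracket ?b (?p (pderiv q) w) \<in> W'"
      using subspace_diff[OF sub_W' _ bracket_poly_action[OF comm w, of q]] by fastforce
    then show ?thesis using inj poly_action_bracket_closed[OF w] by blast
  qed
  then have "pderiv q = 0 \<or> degree q \<le> degree (pderiv q)"
    using min unfolding Q_def by blast
  then have "degree q = 0" by (auto simp: pderiv_eq_0_iff degree_pderiv)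
  then obtain c where c: "q = [:c:]" by (rule degree_eq_zeroE)
  then have "c \<noteq> 0" using q by (simp add: Q_def)
  have "w \<in> W'" if "w \<in> W" for w
  proof -
    have "scale c w \<in> W'"
      using q that unfolding Q_def c
      by (simp add: ad.poly_action_pCons ad.poly_action_0
          bilinear)
    then have "scale (inverse c) (scale c w) \<in> W'" by (rule subspace_scale[OF sub_W'])
    then show ?thesis using \<open>c \<noteq> 0\<close> by simp
  qed
  then show False using proper by blast
qed

text \<open>Each \<open>b \<in> S\<close> is locally nilpotent on \<open>W / W'\<close> by the preceding lemmas. The common kernel of
  the commuting family \<open>S\<close> is an ideal, so it is all of \<open>W\<close>.\<close>

lemma commutators_act_trivially:
  assumes mult_S: "\<And>b w. b \<in> span S \<Longrightarrow> w \<in> W \<Longrightarrow> b \<cdot> w \<in> W'"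
    and comm: "\<And>b c w. b \<in> span S \<Longrightarrow> c \<in> span S \<Longrightarrow> w \<in> W \<Longrightarrow> bracket (bracket b c) w \<in> W'"
    and invariant: "\<And>b y. b \<in> span S \<Longrightarrow> bracket y b \<in> span S"
    and commutator: "\<And>b. b \<in> S \<Longrightarrow>
      \<exists>x a. b = bracket x a \<and> (\<forall>w\<in>W. bracket (bracket b a) w \<in> W')"
    and b: "b \<in> span S" and w: "w \<in> W"
  shows "bracket b w \<in> W'"
proof -
  have invariant': "bracket b y \<in> span S" if "b \<in> span S" for b y
    using invariant[OF that] by (subst bracket_skew) (rule span_neg)
  have nil: "\<exists>n. (bracket b ^^ n) w \<in> W'" if b: "b \<in> S" and w: "w \<in> W" for b w
  proof -
    have bS: "b \<in> span S" using b by (rule span_base)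
    obtain x a where a: "b = bracket x a" "\<forall>w\<in>W. bracket (bracket b a) w \<in> W'"
      using commutator[OF b] by blast
    have "\<not> (\<forall>w\<in>W. bracket b w \<in> W' \<longrightarrow> w \<in> W')"
      using commutator_not_injective[of x a] a by blast
    moreover have "(\<forall>w\<in>W. \<exists>n. (bracket b ^^ n) w \<in> W') \<or> (\<forall>w\<in>W. bracket b w \<in> W' \<longrightarrow> w \<in> W')"
      by (rule locally_nilpotent_or_injective)
        (rule mult_S[OF invariant'[OF bS]] comm[OF bS invariant[OF bS]], assumption)+
    ultimately show ?thesis using w by blast
  qed
  obtain B where B: "B \<subseteq> S" "independent B" "S \<subseteq> span B"
    by (rule maximal_independent_subset)
  have span_B: "span B = span S"
    using B span_mono[OF B(1)] span_minimal[OF B(3) subspace_span] by blast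
  have "finite B" using B(2) by (rule finiteI_independent)
  then have "\<exists>u\<in>W - W'. \<forall>b\<in>B. bracket b u \<in> W'"
    by (rule common_kernel_vector)
      (use B(1) in \<open>auto intro!: nil comm[OF span_base span_base]\<close>)
  then obtain u where u: "u \<in> W" "u \<notin> W'" "\<forall>b\<in>B. bracket b u \<in> W'" by blast
  define K where "K = {w \<in> W. \<forall>b\<in>span S. bracket b w \<in> W'}"
  have "span B \<subseteq> {b. bracket b u \<in> W'}"
  proof (rule span_minimal)
    show "subspace {b. bracket b u \<in> W'}"
      by (rule subspaceI)
        (auto simp: bilinear subspace_0[OF sub_W'] subspace_add[OF sub_W'] subspace_scale[OF sub_W'])
  qed (use u in auto)
  then have "u \<in> K" using u(1) by (auto simp: K_def span_B)
  moreover have "ideal K"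
    unfolding ideal_iff
  proof (intro conjI ballI allI)
    show sub: "subspace K"
      by (rule subspaceI)
        (auto simp: K_def bilinear subspace_0[OF sub_W'] subspace_add[OF sub_W']
          subspace_scale[OF sub_W'] subspace_0[OF sub_W] subspace_add[OF sub_W]
          subspace_scale[OF sub_W])
    fix w y assume w: "w \<in> K"
    have "bracket b (w \<cdot> y) \<in> W'" if "b \<in> span S" for b
    proof -
      have "w \<cdot> bracket b y \<in> W'"
        using mult_S[OF invariant'[OF that]] w by (simp add: K_def mult_commute)
      then show ?thesis
        using w that by (simp add: K_def leibniz_right subspace_add[OF sub_W'] closed_W')
    qed
    then show "w \<cdot> y \<in> K" using w by (simp add: K_def closed_W)
    have "bracket b (bracket w y) \<in> W'" if "b \<in> span S" for b
    proof -
      have "bracket w (bracket b y) \<in> W'"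
        using w invariant'[OF that, of y] subspace_neg[OF sub_W']
        by (subst bracket_skew) (auto simp: K_def)
      then show ?thesis
        using w that
        by (simp add: K_def jacobi_derivation[of b w y] subspace_add[OF sub_W'] closed_W')
    qed
    then show "bracket w y \<in> K" using w by (simp add: K_def closed_W)
  qed
  moreover have "W' \<subseteq> K" using proper by (auto simp: K_def closed_W')
  moreover have "K \<subseteq> W" by (auto simp: K_def)
  ultimately have "K = W" using chief u(2) by blast
  then show ?thesis using b w by (auto simp: K_def)
qed

lemma bracket_span_acts_trivially:
  assumes X: "ideal X" and Y: "ideal Y"
    and mult: "\<And>b w. b \<in> bracket_span X Y \<Longrightarrow> w \<in> W \<Longrightarrow> b \<cdot> w \<in> W'"
    and comm: "\<And>b c w. b \<in> bracket_span X Y \<Longrightarrow> c \<in> bracket_span X Y \<Longrightarrow> w \<in> W \<Longrightarrow>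
      bracket (bracket b c) w \<in> W'"
    and commutator: "\<And>x a w. x \<in> X \<Longrightarrow> a \<in> Y \<Longrightarrow> w \<in> W \<Longrightarrow>
      bracket (bracket (bracket x a) a) w \<in> W'"
    and b: "b \<in> bracket_span X Y" and w: "w \<in> W"
  shows "bracket b w \<in> W'"
proof (rule commutators_act_trivially)
  let ?S = "{bracket x a | x a. x \<in> X \<and> a \<in> Y}"
  have S: "span ?S = bracket_span X Y" by (simp add: bracket_span_def)
  show "b \<in> span ?S" unfolding S by (rule b)
  show "b \<cdot> w \<in> W'" if "b \<in> span ?S" "w \<in> W" for b w
    using that unfolding S by (rule mult)
  show "bracket (bracket b c) w \<in> W'" if "b \<in> span ?S" "c \<in> span ?S" "w \<in> W" for b c w
    using that unfolding S by (rule comm)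
  show "bracket y b \<in> span ?S" if "b \<in> span ?S" for b y
    using that unfolding S by (rule bracket_span_invariant[OF X Y])
  show "\<exists>x a. b = bracket x a \<and> (\<forall>w\<in>W. bracket (bracket b a) w \<in> W')" if "b \<in> ?S" for b
    using that commutator by blast
qed (rule w)

text \<open>Descending induction along the derived series \<open>D n\<close> of \<open>I\<close>. Suppose \<open>D (n + 2)\<close> acts
  trivially, that is, \<open>A = D (n + 1)\<close> acts by commuting operators. Applied to the brackets of
  arbitrary elements with elements of \<open>A\<close>, the preceding lemma makes \<open>A\<close> act centrally. Applied
  to the brackets of elements of \<open>D n\<close>, which are then central, it makes these act trivially. The
  remaining generators \<open>x \<cdot> y\<close> of \<open>A\<close> act trivially by the Leibniz rule, because \<open>x\<close> and \<open>y\<close>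
  multiply \<open>W\<close> into \<open>W'\<close>.\<close>

lemma solvable_ideal_square_acts_trivially:
  assumes I: "ideal I" "solvable I" and z: "z \<in> square I" and w: "w \<in> W"
  shows "z \<cdot> w \<in> W'" and "bracket z w \<in> W'"
proof -
  let ?D = "derived I"
  have ideal_D: "ideal (?D n)" for n by (rule ideal_derived[OF I(1)])
  have mult_I: "x \<cdot> w \<in> W'" if "x \<in> I" "w \<in> W" for x w
    using solvable_ideal_mult_trivial[OF I that] .
  have mult_D: "x \<cdot> w \<in> W'" if "x \<in> ?D n" "w \<in> W" for x w n
    using mult_I derived_antimono[OF I(1)] that by blast
  have step: "\<forall>b\<in>?D (Suc n). \<forall>w\<in>W. bracket b w \<in> W'"
    if IH: "\<forall>b\<in>?D (Suc (Suc n)). \<forall>w\<in>W. bracket b w \<in> W'" for n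
  proof -
    let ?A = "?D (Suc n)"
    \<comment> \<open>Elements of \<open>?A\<close> commute on \<open>W / W'\<close>, as their brackets lie in the next derived term.\<close>
    have comm_A: "bracket (bracket b c) w \<in> W'" if "b \<in> ?A" "c \<in> ?A" "w \<in> W" for b c w
      using IH that by (simp add: square_eq_product_span product_spanI)
    have central: "bracket b w \<in> W'" if b: "b \<in> bracket_span UNIV ?A" and w: "w \<in> W" for b w
    proof (rule bracket_span_acts_trivially[OF ideal_UNIV ideal_D _ _ _ b w])
      have in_A: "bracket x a \<in> ?A" if "a \<in> ?A" for x a
        using ideal_D that by (rule ideal_closed)
      have le: "bracket_span UNIV ?A \<subseteq> ?A"
        using in_A by (simp only: bracket_span_subset_iff[OF ideal_subspace[OF ideal_D]]) blast
      show "b \<cdot> w \<in> W'" if "b \<in> bracket_span UNIV ?A" "w \<in> W" for b w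
        using le that mult_D by blast
      show "bracket (bracket b c) w \<in> W'"
        if "b \<in> bracket_span UNIV ?A" "c \<in> bracket_span UNIV ?A" "w \<in> W" for b c w
        by (rule comm_A) (use le that in blast)+
      show "bracket (bracket (bracket x a) a) w \<in> W'" if "a \<in> ?A" "w \<in> W" for x a w
        by (rule comm_A) (use in_A that in blast)+
    qed
    have in_A: "bracket x a \<in> ?A" if "x \<in> ?D n" "a \<in> ?D n" for x a
      using that by (simp add: square_eq_product_span product_spanI)
    have brackets: "bracket b w \<in> W'" if b: "b \<in> bracket_span (?D n) (?D n)" and w: "w \<in> W" for b w
    proof (rule bracket_span_acts_trivially[OF ideal_D ideal_D _ _ _ b w])
      have le: "bracket_span (?D n) (?D n) \<subseteq> ?A"
        using in_A by (simp only: bracket_span_subset_iff[OF ideal_subspace[OF ideal_D]]) blast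
      show "b \<cdot> w \<in> W'" if "b \<in> bracket_span (?D n) (?D n)" "w \<in> W" for b w
        using le that mult_D by blast
      show "bracket (bracket b c) w \<in> W'"
        if "b \<in> bracket_span (?D n) (?D n)" "c \<in> bracket_span (?D n) (?D n)" "w \<in> W" for b c w
        by (rule comm_A) (use le that in blast)+
      show "bracket (bracket (bracket x a) a) w \<in> W'" if "x \<in> ?D n" "a \<in> ?D n" "w \<in> W" for x a w
      proof -
        have sub: "subspace (bracket_span UNIV ?A)" by (rule subspace_product_spans)
        have "bracket a (bracket x a) \<in> bracket_span UNIV ?A"
          using in_A[OF that(1,2)] bracket_span_subset_iff[OF sub, of UNIV ?A] by blast
        then have "bracket (bracket x a) a \<in> bracket_span UNIV ?A"
          by (subst bracket_skew) (rule subspace_neg[OF sub])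
        then show ?thesis using that(3) by (rule central)
      qed
    qed
    have "?A \<subseteq> {b. \<forall>w\<in>W. bracket b w \<in> W'}" (is "_ \<subseteq> ?U")
    proof -
      have U: "subspace ?U"
        by (rule subspaceI)
          (auto simp: bilinear subspace_0[OF sub_W'] subspace_add[OF sub_W'] subspace_scale[OF sub_W'])
      have "x \<cdot> y \<in> ?U \<and> bracket x y \<in> ?U" if x: "x \<in> ?D n" and y: "y \<in> ?D n" for x y
      proof -
        have "bracket (x \<cdot> y) w \<in> W'" if w: "w \<in> W" for w
        proof -
          have "bracket x w \<cdot> y \<in> W'"
            using mult_D[OF y closed_W(4)[OF w]] by (simp add: mult_commute)
          moreover have "x \<cdot> bracket y w \<in> W'"
            using mult_D[OF x closed_W(4)[OF w]] .
          ultimately show ?thesis by (simp add: leibniz subspace_add[OF sub_W'])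
        qed
        moreover have "bracket x y \<in> bracket_span (?D n) (?D n)"
          using x y bracket_span_subset_iff[OF subspace_product_spans(2), of "?D n" "?D n"] by blast
        ultimately show ?thesis using brackets by blast
      qed
      then show ?thesis
        by (simp add: square_eq_product_span product_span_subset_iff[OF U])
    qed
    then show ?thesis by blast
  qed
  obtain m where m: "?D m = {0}" using I(2) unfolding solvable_def by blast
  have "?D (Suc m) = {0}"
    using derived_antimono[OF ideal_zero, of 1] subspace_0[OF ideal_subspace[OF ideal_D[of "Suc m"]]]
    by (auto simp: m)
  then have "\<forall>b\<in>?D (Suc m). \<forall>w\<in>W. bracket b w \<in> W'"
    by (simp add: bilinear subspace_0[OF sub_W'])
  then have "\<forall>b\<in>?D (Suc 0). \<forall>w\<in>W. bracket b w \<in> W'"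
  proof (induction m)
    case (Suc m)
    then show ?case using step by (simp del: derived.simps)
  qed
  then show "bracket z w \<in> W'" using z w by simp
  show "z \<cdot> w \<in> W'" using mult_D[of z 1 w] z w by simp
qed

end

section \<open>Nilpotency of the square of a solvable ideal\<close>

text \<open>Each factor of a chief series from the whole algebra down to zero is killed by \<open>square I\<close>,
  so sufficiently long right-normed products of elements of \<open>square I\<close> vanish.\<close>

lemma nilpotent_square_solvable_ideal:
  fixes scale :: "'f::field_char_0 \<Rightarrow> 'p::ab_group_add \<Rightarrow> 'p"
    and mult bracket :: "'p \<Rightarrow> 'p \<Rightarrow> 'p"
  assumes "poisson_algebra scale mult bracket" "finite_dimensional_vector_space scale Basis"
    and "poisson_algebra.ideal scale mult bracket I" "poisson_algebra.solvable scale mult bracket I"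
  shows "poisson_algebra.nilpotent scale mult bracket (poisson_algebra.square scale mult bracket I)"
proof -
  interpret poisson_algebra scale mult bracket by fact
  interpret finite_dimensional_vector_space scale Basis by fact
  let ?act = "product_span (square I)"
  have "\<exists>n. (?act ^^ n) W \<subseteq> {0}" if "ideal W" for W
    using that
  proof (induction "dim W" arbitrary: W rule: less_induct)
    case less
    show ?case
    proof (cases "W = {0}")
      case True
      then show ?thesis by (intro exI[of _ 0]) simp
    next
      case False
      let ?Q = "\<lambda>U. ideal U \<and> U \<subset> W"
      have "?Q {0}"
        using False subspace_0[OF ideal_subspace[OF less.prems]] ideal_zero by blast
      moreover have "subspace U" if "?Q U" for U using that ideal_subspace by blast
      ultimately obtain W' where W': "?Q W'" and max: "\<And>U. ?Q U \<Longrightarrow> W' \<subseteq> U \<Longrightarrow> U = W'"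
        using subspace_of_maximal_dim[of ?Q "{0}"] by blast
      interpret finite_dimensional_chief_factor scale mult bracket W W' Basis
        by unfold_locales (use less.prems W' max in blast)+
      have "?act W \<subseteq> W'"
        using solvable_ideal_square_acts_trivially[OF assms(3,4)]
        by (subst product_span_subset_iff) (auto simp: sub_W')
      moreover have "\<exists>n. (?act ^^ n) W' \<subseteq> {0}"
        using W' subspace_dim_equal[OF sub_W' sub_W] by (intro less.hyps) (auto simp: not_le[symmetric])
      then obtain n where "(?act ^^ n) W' \<subseteq> {0}" by blast
      moreover have "mono (?act ^^ n)"
        by (intro mono_pow monoI product_span_mono) auto
      ultimately have "(?act ^^ n) (?act W) \<subseteq> {0}" by (meson monoD order_trans)
      then show ?thesis by (intro exI[of _ "Suc n"]) (simp add: funpow_swap1)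
    qed
  qed
  then obtain n where n: "(?act ^^ n) UNIV \<subseteq> {0}" using ideal_UNIV by blast
  have "mono (?act ^^ n)"
    by (intro mono_pow monoI product_span_mono) auto
  then have "lower_central (square I) n \<subseteq> {0}"
    unfolding lower_central_def using n monoD[of "?act ^^ n" "square I" UNIV] by blast
  then show ?thesis
    by (intro nilpotent_if_lower_central_zero) (simp_all add: square_eq_product_span subspace_product_spans)
qed

theorem corollary2p6:
  fixes scale :: "'f::field_char_0 \<Rightarrow> 'p::ab_group_add \<Rightarrow> 'p"
    and mult bracket :: "'p \<Rightarrow> 'p \<Rightarrow> 'p"
    and Basis R :: "'p set"
  assumes "poisson_algebra scale mult bracket"
    and "finite_dimensional_vector_space scale Basis"
    and "R = poisson_algebra.radical scale mult bracket"
  shows "poisson_algebra.nilpotent scale mult bracket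
           (poisson_algebra.mult_span scale mult R R + poisson_algebra.bracket_span scale bracket R R)"
proof -
  interpret poisson_algebra scale mult bracket by fact
  have "ideal R \<and> solvable R"
    unfolding assms(3) by (rule radical_solvable_ideal) fact
  then have "nilpotent (square R)"
    using nilpotent_square_solvable_ideal[OF assms(1,2)] by blast
  then show ?thesis by (simp add: square_def)
qed

end
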